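(* Let $e$ be a finite set, $K>0$, and let $g_e:2^e\to\mathbb{R}_{\ge0}$ be either $g_e(S)=\min(|S|,K)$ or $g_e(S)=\min(|S|,|e\setminus S|,K)$. Then for every $\epsilon\in(0,1)$, $g_e$ is $(1+\epsilon)$-approximable with support size $O(\epsilon^{-2}(|e|/K)\log|e|)$.
   Context: A function $g_e:2^e\to\mathbb{R}_{\ge0}$ is $(1+\epsilon)$-approximable with support size $p$ if there are sets $e_1,\dots,e_r\subseteq e$ with $|e_i|\le p$ and submodular functions $g_{e_i}:2^{e_i}\to\mathbb{R}_{\ge0}$ such that $\sum_{i=1}^r g_{e_i}(S\cap e_i)\in[(1-\epsilon)g_e(S),(1+\epsilon)g_e(S)]$ for all $S\subseteq e$. The $O(\cdot)$ hides an absolute constant.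
   Formalization: The support-size bound is proved with min(K,|e|) in place of K and log max(2,|e|) in place of log|e|; the literal bound fails for |e|=1 and for K much larger than |e|, where it falls below 1. For |e|≥2 and K≤|e| the two bounds agree. *)

theory Defs
  imports Complex_Main
begin

text \<open>
  A function on the power set of \<open>e\<close> is a total function \<open>'a set \<Rightarrow> real\<close> whose values are only
  constrained on subsets of \<open>e\<close>.
\<close>

definition nonneg_on_subsets :: "'a set \<Rightarrow> ('a set \<Rightarrow> real) \<Rightarrow> bool" where
  "nonneg_on_subsets e g \<longleftrightarrow> (\<forall>S. S \<subseteq> e \<longrightarrow> 0 \<le> g S)"

definition submodular_on_subsets :: "'a set \<Rightarrow> ('a set \<Rightarrow> real) \<Rightarrow> bool" where
  "submodular_on_subsets e g \<longleftrightarrow>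
     (\<forall>S T. S \<subseteq> e \<longrightarrow> T \<subseteq> e \<longrightarrow> g (S \<union> T) + g (S \<inter> T) \<le> g S + g T)"

text \<open>
  \<open>approximable e g \<epsilon> p\<close>: the function \<open>g\<close> on the subsets of \<open>e\<close> is \<open>(1 + \<epsilon>)\<close>-approximable
  with support size \<open>p\<close>.
\<close>

definition approximable :: "'a set \<Rightarrow> ('a set \<Rightarrow> real) \<Rightarrow> real \<Rightarrow> nat \<Rightarrow> bool" where
  "approximable e g \<epsilon> p \<longleftrightarrow>
     nonneg_on_subsets e g \<and>
     (\<exists>(r::nat) (E :: nat \<Rightarrow> 'a set) (h :: nat \<Rightarrow> 'a set \<Rightarrow> real).
        (\<forall>i\<in>{1..r}. E i \<subseteq> e \<and> card (E i) \<le> p \<and>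
            nonneg_on_subsets (E i) (h i) \<and> submodular_on_subsets (E i) (h i)) \<and>
        (\<forall>S. S \<subseteq> e \<longrightarrow>
            (\<Sum>i=1..r. h i (S \<inter> E i)) \<in> {(1 - \<epsilon>) * g S .. (1 + \<epsilon>) * g S}))"

text \<open>
  The support-size bound \<open>\<epsilon>\<^sup>-\<^sup>2 (|e|/K) log |e|\<close> degenerates for \<open>K\<close> much larger than \<open>|e|\<close> and for
  \<open>|e| = 1\<close>: it drops below 1, which no approximation of a nonzero \<open>g\<close> can meet. It is
  therefore stated with \<open>min K |e|\<close> for \<open>K\<close>, which leaves \<open>min |S| K\<close> and \<open>min |S| |e - S| K\<close> unchanged,
  and \<open>max 2 |e|\<close> inside the logarithm. For \<open>K \<le> |e|\<close> and \<open>|e| \<ge> 2\<close> both are vacuous.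
\<close>

end

theory Submission
  imports Defs
begin

text \<open>
  Draw \<open>p\<close> elements of \<open>e\<close> independently and uniformly, and let \<open>X\<close> be the number of draws that hit \<open>S\<close>.
  With \<open>n = |e|\<close> and \<open>L = K p / n\<close>, the average of \<open>(n / p) min X L\<close> over all \<open>n ^ p\<close> samples is at most
  \<open>min |S| K\<close> by Jensen's inequality, and it is at least \<open>(1 - \<epsilon>) min |S| K\<close> once \<open>\<epsilon>\<^sup>2 L \<ge> 1\<close>, because
  \<open>X\<close> has variance at most its mean. The number of summands is unrestricted, so all samples can be
  used at once and no concentration bound (and no logarithm) is needed. The second function reduces
  to the first one, since \<open>min a (min b K) = min a K + min b K - K\<close> whenever \<open>2 K \<le> a + b\<close>.
\<close>

section \<open>Samples with replacement and their hit counts\<close>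

text \<open>Lists keep order and repetitions, so the draws are independent and uniform; expectations
  become plain sums divided by \<open>card e ^ p\<close>.\<close>

definition samples :: "nat \<Rightarrow> 'a set \<Rightarrow> 'a list set" where
  "samples p e = {xs. set xs \<subseteq> e \<and> length xs = p}"

definition hits :: "'a set \<Rightarrow> 'a list \<Rightarrow> real" where
  "hits S xs = real (length (filter (\<lambda>x. x \<in> S) xs))"

lemma finite_samples: "finite e \<Longrightarrow> finite (samples p e)"
  unfolding samples_def by (rule finite_lists_length_eq)

lemma card_samples: "finite e \<Longrightarrow> card (samples p e) = card e ^ p"
  unfolding samples_def by (rule card_lists_length_eq)

lemma samples_0: "samples 0 e = {[]}"
  by (auto simp: samples_def)

text \<open>Splitting off one draw; this drives the inductions on \<open>p\<close> for the
  moments.\<close>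

lemma sum_samples_Suc:
  "(\<Sum>xs\<in>samples (Suc p) e. f xs) = (\<Sum>xs\<in>samples p e. \<Sum>x\<in>e. f (x # xs))"
proof -
  have "samples (Suc p) e = (\<lambda>(xs, x). x # xs) ` (samples p e \<times> e)"
    by (auto simp: samples_def length_Suc_conv image_iff)
  moreover have "inj_on (\<lambda>(xs, x). x # xs) (samples p e \<times> e)"
    by (auto simp: inj_on_def)
  ultimately show ?thesis
    by (simp add: sum.reindex sum.cartesian_product case_prod_unfold)
qed

lemma hits_Nil: "hits S [] = 0"
  by (simp add: hits_def)

lemma hits_Cons: "hits S (x # xs) = of_bool (x \<in> S) + hits S xs"
  by (simp add: hits_def)

lemma hits_nonneg: "0 \<le> hits S xs"
  by (simp add: hits_def)

lemma hits_mono: "S \<subseteq> T \<Longrightarrow> hits S xs \<le> hits T xs"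
  by (induction xs) (auto simp: hits_Nil hits_Cons of_bool_def)

lemma hits_modular: "hits (S \<union> T) xs + hits (S \<inter> T) xs = hits S xs + hits T xs"
  by (induction xs) (auto simp: hits_Nil hits_Cons of_bool_def)

text \<open>Makes \<open>set xs\<close> a legitimate support: a function of \<open>hits S xs\<close>
  sees only the part of \<open>S\<close> inside \<open>set xs\<close>.\<close>

lemma hits_Int_set: "hits (S \<inter> set xs) xs = hits S xs"
  unfolding hits_def by (metis (mono_tags, lifting) Int_iff filter_cong)

text \<open>Every draw lies in \<open>e\<close> and so hits exactly one of \<open>S\<close> and
  \<open>e - S\<close>.\<close>

lemma hits_complement: "xs \<in> samples p e \<Longrightarrow> hits (e - S) xs = real p - hits S xs"
proof (induction xs arbitrary: p)
  case Nil
  then show ?case by (simp add: hits_Nil samples_def)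
next
  case (Cons x xs)
  then have "xs \<in> samples (p - 1) e" "p > 0" "x \<in> e"
    by (auto simp: samples_def)
  with Cons.IH[of "p - 1"] show ?case
    by (auto simp: hits_Cons of_nat_diff)
qed

section \<open>First and second moments of the hit count\<close>

text \<open>Deviations are scaled by \<open>card e\<close>, which keeps the moment identities free
  of division and valid for empty \<open>e\<close>.\<close>

lemma sum_of_bool_centred:
  assumes "finite e" "S \<subseteq> e"
  shows "(\<Sum>x\<in>e. real (card e) * of_bool (x \<in> S) - real (card S)) = 0"
proof -
  have "e \<inter> S = S" using assms by auto
  with assms show ?thesis
    by (simp add: sum_subtractf flip: sum_distrib_left)
qed

lemma sum_of_bool_centred_sq:
  assumes "finite e" "S \<subseteq> e"
  shows "(\<Sum>x\<in>e. (real (card e) * of_bool (x \<in> S) - real (card S))\<^sup>2)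
    = real (card e) * real (card S) * (real (card e) - real (card S))"
proof -
  let ?n = "real (card e)" and ?s = "real (card S)"
  have "e \<inter> S = S" using assms by auto
  have "(\<Sum>x\<in>e. (?n * of_bool (x \<in> S) - ?s)\<^sup>2)
      = (\<Sum>x\<in>e. (?n\<^sup>2 - 2 * ?n * ?s) * of_bool (x \<in> S) + ?s\<^sup>2)"
    by (rule sum.cong) (auto simp: power2_eq_square algebra_simps)
  also have "\<dots> = (?n\<^sup>2 - 2 * ?n * ?s) * ?s + ?n * ?s\<^sup>2"
    using assms \<open>e \<inter> S = S\<close> by (simp add: sum.distrib flip: sum_distrib_left)
  also have "\<dots> = ?n * ?s * (?n - ?s)"
    by (simp add: power2_eq_square algebra_simps)
  finally show ?thesis .
qed

lemma sum_hits_centred: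
  assumes "finite e" "S \<subseteq> e"
  shows "(\<Sum>xs\<in>samples p e. real (card e) * hits S xs - real p * real (card S)) = 0"
proof (induction p)
  case 0
  then show ?case by (simp add: samples_0 hits_Nil)
next
  case (Suc p)
  let ?n = "real (card e)" and ?s = "real (card S)"
  have "(\<Sum>x\<in>e. ?n * hits S (x # xs) - real (Suc p) * ?s) = ?n * (?n * hits S xs - real p * ?s)" for xs
  proof -
    have "(\<Sum>x\<in>e. ?n * hits S (x # xs) - real (Suc p) * ?s)
        = (\<Sum>x\<in>e. (?n * of_bool (x \<in> S) - ?s) + (?n * hits S xs - real p * ?s))"
      by (rule sum.cong) (auto simp: hits_Cons algebra_simps)
    then show ?thesis
      unfolding sum.distrib sum_of_bool_centred[OF assms] by simp
  qed
  then show ?case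
    using Suc by (simp add: sum_samples_Suc flip: sum_distrib_left)
qed

text \<open>Variances of independent draws add: in the square of (new draw + earlier draws) the
  cross term vanishes, because the centred indicator of the new draw sums to 0.\<close>

lemma sum_hits_centred_sq:
  assumes "finite e" "S \<subseteq> e"
  shows "(\<Sum>xs\<in>samples p e. (real (card e) * hits S xs - real p * real (card S))\<^sup>2)
    = real (card e) ^ p * (real p * real (card S) * (real (card e) - real (card S)))"
proof (induction p)
  case 0
  then show ?case by (simp add: samples_0 hits_Nil)
next
  case (Suc p)
  let ?n = "real (card e)" and ?s = "real (card S)"
  have "(\<Sum>x\<in>e. (?n * hits S (x # xs) - real (Suc p) * ?s)\<^sup>2)
      = ?n * ?s * (?n - ?s) + ?n * (?n * hits S xs - real p * ?s)\<^sup>2" for xs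
  proof -
    let ?d = "?n * hits S xs - real p * ?s"
    have "(\<Sum>x\<in>e. (?n * hits S (x # xs) - real (Suc p) * ?s)\<^sup>2)
        = (\<Sum>x\<in>e. (?n * of_bool (x \<in> S) - ?s)\<^sup>2 + 2 * ?d * (?n * of_bool (x \<in> S) - ?s) + ?d\<^sup>2)"
      by (rule sum.cong[OF refl]) (simp only: hits_Cons of_nat_Suc power2_eq_square, algebra)
    then show ?thesis
      unfolding sum.distrib sum_of_bool_centred_sq[OF assms] sum_distrib_left[symmetric]
        sum_of_bool_centred[OF assms] by simp
  qed
  then have "(\<Sum>xs\<in>samples (Suc p) e. (?n * hits S xs - real (Suc p) * ?s)\<^sup>2)
      = ?n ^ p * (?n * ?s * (?n - ?s))
        + ?n * (\<Sum>xs\<in>samples p e. (?n * hits S xs - real p * ?s)\<^sup>2)"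
    using assms(1) by (simp add: sum_samples_Suc sum.distrib card_samples flip: sum_distrib_left)
  also have "\<dots> = ?n ^ Suc p * (real (Suc p) * ?s * (?n - ?s))"
    unfolding Suc by (simp add: algebra_simps)
  finally show ?case .
qed

lemma sum_hits:
  assumes "finite e" "S \<subseteq> e" "card e > 0"
  shows "(\<Sum>xs\<in>samples p e. hits S xs) = real (card e) ^ p * (real p * real (card S) / real (card e))"
proof -
  have "real (card e) * (\<Sum>xs\<in>samples p e. hits S xs)
      = real (card e) ^ p * (real p * real (card S))"
    using sum_hits_centred[OF assms(1,2), of p] assms(1)
    by (simp add: sum_subtractf card_samples flip: sum_distrib_left)
  then show ?thesis
    using assms(3) by (simp add: field_simps)
qed

lemma sum_hits_deviation_le:
  fixes p :: nat
  assumes "finite e" "S \<subseteq> e" "card e > 0"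
  defines "\<mu> \<equiv> real p * real (card S) / real (card e)"
  shows "(\<Sum>xs\<in>samples p e. (hits S xs - \<mu>)\<^sup>2) \<le> real (card e) ^ p * \<mu>"
proof -
  let ?n = "real (card e)" and ?s = "real (card S)"
  have n: "?n > 0" using assms(3) by simp
  have "?n\<^sup>2 * (\<Sum>xs\<in>samples p e. (hits S xs - \<mu>)\<^sup>2)
      = (\<Sum>xs\<in>samples p e. (?n * hits S xs - real p * ?s)\<^sup>2)"
    unfolding sum_distrib_left
  proof (rule sum.cong[OF refl])
    fix xs
    have "?n * hits S xs - real p * ?s = ?n * (hits S xs - \<mu>)"
      using n by (simp add: \<mu>_def field_simps)
    then show "?n\<^sup>2 * (hits S xs - \<mu>)\<^sup>2 = (?n * hits S xs - real p * ?s)\<^sup>2"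
      by (simp add: power_mult_distrib)
  qed
  also have "\<dots> = ?n ^ p * (real p * ?s * (?n - ?s))"
    by (rule sum_hits_centred_sq[OF assms(1,2)])
  \<comment> \<open>This drops the factor \<open>1 - ?s / ?n\<close> of the binomial variance,
    leaving the mean as the bound.\<close>
  also have "\<dots> \<le> ?n ^ p * (real p * ?s * ?n)"
    by (intro mult_left_mono) auto
  also have "\<dots> = ?n\<^sup>2 * (?n ^ p * \<mu>)"
    using n by (simp add: \<mu>_def power2_eq_square)
  finally show ?thesis
    using n by simp
qed

section \<open>Averages of a truncated variable\<close>

text \<open>Jensen's inequality for the concave map \<open>min x L\<close>, by bounding the
  truncation by each of its two arguments.\<close>

lemma sum_min_le:
  fixes X :: "'i \<Rightarrow> real"
  assumes "(\<Sum>i\<in>I. X i) = real (card I) * \<mu>"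
  shows "(\<Sum>i\<in>I. min (X i) L) \<le> real (card I) * min \<mu> L"
proof -
  have "(\<Sum>i\<in>I. min (X i) L) \<le> (\<Sum>i\<in>I. X i)" "(\<Sum>i\<in>I. min (X i) L) \<le> (\<Sum>i\<in>I. L)"
    by (intro sum_mono; simp)+
  with assms show ?thesis by (simp add: min_def)
qed

text \<open>
  Both cases bound \<open>min x L\<close> below by a parabola touching it on either side of the kink; the
  parameter \<open>a\<close> makes the parabola's error at the mean equal to a multiple of \<open>(\<epsilon> min \<mu> L)\<^sup>2\<close>.
\<close>

lemma sum_min_ge:
  fixes X :: "'i \<Rightarrow> real"
  assumes mean: "(\<Sum>i\<in>I. X i) = real (card I) * \<mu>"
    and var: "(\<Sum>i\<in>I. (X i - \<mu>)\<^sup>2) \<le> real (card I) * \<mu>"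
    and mu: "0 \<le> \<mu>" and eps: "0 < \<epsilon>" "\<epsilon> < 1" and L: "1 \<le> \<epsilon>\<^sup>2 * L"
  shows "real (card I) * ((1 - \<epsilon>) * min \<mu> L) \<le> (\<Sum>i\<in>I. min (X i) L)"
proof -
  let ?N = "real (card I)"
  have L0: "L > 0"
    using L eps by (smt (verit) mult_nonneg_nonpos zero_le_power2)
  have eL: "1 \<le> \<epsilon> * L"
  proof -
    have "\<epsilon>\<^sup>2 * L \<le> \<epsilon> * L"
      using eps L0 by (intro mult_right_mono) (auto simp: power2_eq_square)
    with L show ?thesis by linarith
  qed
  have dev: "(\<Sum>i\<in>I. X i - \<mu>) = 0"
    using mean by (simp add: sum_subtractf)
  \<comment> \<open>Deviations from the mean sum to 0, so shifting them by \<open>t\<close> adds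
    exactly \<open>t\<^sup>2\<close> to the mean square. Below, \<open>t\<close> is the signed gap
    between the mean and a contact point of the parabola.\<close>
  have sq: "(\<Sum>i\<in>I. (X i - \<mu> + t)\<^sup>2) \<le> ?N * (\<mu> + t\<^sup>2)" for t
  proof -
    have "(\<Sum>i\<in>I. (X i - \<mu> + t)\<^sup>2) = (\<Sum>i\<in>I. (X i - \<mu>)\<^sup>2 + 2 * t * (X i - \<mu>) + t\<^sup>2)"
      by (rule sum.cong[OF refl]) algebra
    also have "\<dots> = (\<Sum>i\<in>I. (X i - \<mu>)\<^sup>2) + ?N * t\<^sup>2"
      unfolding sum.distrib sum_distrib_left[symmetric] dev by simp
    finally show ?thesis using var by (simp add: algebra_simps)
  qed
  show ?thesis
  proof (cases "\<mu> \<le> L")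
    case True
    define a where "a = L - \<mu> + \<epsilon> * \<mu>"
    have a: "a > 0"
      using True L0 mu eps by (cases "\<mu> = 0") (auto simp: a_def add_nonneg_pos)
    \<comment> \<open>The contact points are \<open>(1 - \<epsilon>) * \<mu>\<close>, which is
      \<open>L - a\<close>, on the rising branch and \<open>L + a\<close> on the flat one.\<close>
    have "x - (x - \<mu> + \<epsilon> * \<mu>)\<^sup>2 / (4 * a) \<le> min x L" for x
    proof -
      have shift: "x - \<mu> + \<epsilon> * \<mu> = x - L + a" by (simp add: a_def)
      have "4 * a * (x - L) \<le> (x - L + a)\<^sup>2"
        using zero_le_power2[of "x - L - a"] by (simp add: power2_eq_square algebra_simps)
      then have "x - L \<le> (x - L + a)\<^sup>2 / (4 * a)"
        using a by (simp add: pos_le_divide_eq mult.commute)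
      moreover have "0 \<le> (x - L + a)\<^sup>2 / (4 * a)"
        using a by simp
      ultimately show ?thesis
        unfolding shift min_def by (smt (verit))
    qed
    then have "(\<Sum>i\<in>I. X i - (X i - \<mu> + \<epsilon> * \<mu>)\<^sup>2 / (4 * a)) \<le> (\<Sum>i\<in>I. min (X i) L)"
      by (intro sum_mono)
    then have lower: "?N * \<mu> - (\<Sum>i\<in>I. (X i - \<mu> + \<epsilon> * \<mu>)\<^sup>2) / (4 * a) \<le> (\<Sum>i\<in>I. min (X i) L)"
      by (simp add: sum_subtractf mean sum_divide_distrib)
    \<comment> \<open>The averaged loss must be at most \<open>\<epsilon> * \<mu>\<close>, which
      amounts to \<open>1 + z \<le> 4 * a * \<epsilon>\<close> for
      \<open>z = \<epsilon>\<^sup>2 * \<mu>\<close>. With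
      \<open>y = \<epsilon> * (L - \<mu>)\<close> the right side is \<open>4 * y + 4 * z\<close>,
      and \<open>1 \<le> y + z\<close> suffices.\<close>
    have "\<epsilon>\<^sup>2 * (L - \<mu>) \<le> \<epsilon> * (L - \<mu>)"
      using True eps by (intro mult_right_mono) (auto simp: power2_eq_square)
    then have "1 - \<epsilon>\<^sup>2 * \<mu> \<le> \<epsilon> * (L - \<mu>)"
      using L by (simp add: algebra_simps)
    moreover have "0 \<le> \<epsilon> * (L - \<mu>)" "0 \<le> \<epsilon>\<^sup>2 * \<mu>"
      using True eps mu by auto
    moreover have "4 * a * \<epsilon> = 4 * (\<epsilon> * (L - \<mu>)) + 4 * (\<epsilon>\<^sup>2 * \<mu>)"
      by (simp add: a_def algebra_simps power2_eq_square)
    ultimately have "1 + \<epsilon>\<^sup>2 * \<mu> \<le> 4 * a * \<epsilon>"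
      by linarith
    then have "\<mu> * (1 + \<epsilon>\<^sup>2 * \<mu>) \<le> \<mu> * (4 * a * \<epsilon>)"
      using mu by (intro mult_left_mono)
    then have "(\<mu> + (\<epsilon> * \<mu>)\<^sup>2) / (4 * a) \<le> \<epsilon> * \<mu>"
      using a by (simp add: field_simps power2_eq_square)
    then have "?N * ((\<mu> + (\<epsilon> * \<mu>)\<^sup>2) / (4 * a)) \<le> ?N * (\<epsilon> * \<mu>)"
      by (intro mult_left_mono) auto
    moreover have "(\<Sum>i\<in>I. (X i - \<mu> + \<epsilon> * \<mu>)\<^sup>2) / (4 * a) \<le> ?N * ((\<mu> + (\<epsilon> * \<mu>)\<^sup>2) / (4 * a))"
      using sq[of "\<epsilon> * \<mu>"] a by (simp add: divide_right_mono)
    ultimately show ?thesis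
      using lower True by (simp add: min_def algebra_simps)
  next
    case False
    define a where "a = \<mu> - L + \<epsilon> * L"
    have a: "a > 0"
      using False L0 eps by (auto simp: a_def add_pos_pos)
    \<comment> \<open>The contact points are now \<open>\<mu> + \<epsilon> * L\<close>, which is
      \<open>L + a\<close>, on the flat branch and \<open>L - a\<close> on the rising one.\<close>
    have "L - (x - \<mu> + (- (\<epsilon> * L)))\<^sup>2 / (4 * a) \<le> min x L" for x
    proof -
      have shift: "x - \<mu> + (- (\<epsilon> * L)) = x - L - a" by (simp add: a_def)
      have "4 * a * (L - x) \<le> (x - L - a)\<^sup>2"
        using zero_le_power2[of "x - L + a"] by (simp add: power2_eq_square algebra_simps)
      then have "L - x \<le> (x - L - a)\<^sup>2 / (4 * a)"
        using a by (simp add: pos_le_divide_eq mult.commute)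
      moreover have "0 \<le> (x - L - a)\<^sup>2 / (4 * a)"
        using a by simp
      ultimately show ?thesis
        unfolding shift min_def by (smt (verit))
    qed
    then have "(\<Sum>i\<in>I. L - (X i - \<mu> + (- (\<epsilon> * L)))\<^sup>2 / (4 * a)) \<le> (\<Sum>i\<in>I. min (X i) L)"
      by (intro sum_mono)
    then have lower: "?N * L - (\<Sum>i\<in>I. (X i - \<mu> + (- (\<epsilon> * L)))\<^sup>2) / (4 * a) \<le> (\<Sum>i\<in>I. min (X i) L)"
      by (simp add: sum_subtractf sum_divide_distrib)
    \<comment> \<open>The goal is \<open>\<mu> + u\<^sup>2 \<le> 4 * a * u\<close>. Split
      \<open>\<mu>\<close> as \<open>(\<mu> - L) + L\<close>: the first part is at most
      \<open>(\<mu> - L) * u\<close> since \<open>1 \<le> u\<close>, the second at most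
      \<open>u\<^sup>2\<close>.\<close>
    define u where "u = \<epsilon> * L"
    have "\<mu> - L \<le> (\<mu> - L) * u"
      using False eL mult_left_mono[of 1 u "\<mu> - L"] by (simp add: u_def)
    moreover have "L * 1 \<le> L * (\<epsilon>\<^sup>2 * L)"
      using L L0 by (intro mult_left_mono) auto
    then have "L \<le> u\<^sup>2"
      by (simp add: u_def power2_eq_square ac_simps)
    moreover have "4 * a * u = 4 * ((\<mu> - L) * u) + 4 * u\<^sup>2"
      by (simp add: a_def u_def algebra_simps power2_eq_square)
    ultimately have "\<mu> + u\<^sup>2 \<le> 4 * a * u"
      using False L0 by linarith
    then have "\<mu> + (\<epsilon> * L)\<^sup>2 \<le> 4 * a * (\<epsilon> * L)"
      unfolding u_def .
    then have "(\<mu> + (\<epsilon> * L)\<^sup>2) / (4 * a) \<le> \<epsilon> * L"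
      using a by (simp add: field_simps)
    then have "?N * ((\<mu> + (\<epsilon> * L)\<^sup>2) / (4 * a)) \<le> ?N * (\<epsilon> * L)"
      by (intro mult_left_mono) auto
    moreover have "(\<Sum>i\<in>I. (X i - \<mu> + (- (\<epsilon> * L)))\<^sup>2) / (4 * a) \<le> ?N * ((\<mu> + (\<epsilon> * L)\<^sup>2) / (4 * a))"
      using sq[of "- (\<epsilon> * L)"] a by (simp add: divide_right_mono)
    ultimately show ?thesis
      using lower False by (simp add: min_def algebra_simps)
  qed
qed

section \<open>The sample average as an estimate of the truncated cardinality\<close>

definition sample_avg :: "nat \<Rightarrow> real \<Rightarrow> 'a set \<Rightarrow> 'a set \<Rightarrow> real" where
  "sample_avg p K e S = real (card e) / (real p * real (card e) ^ p) *
     (\<Sum>xs\<in>samples p e. min (hits S xs) (K * real p / real (card e)))"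

lemma sample_avg_le:
  assumes "finite e" "S \<subseteq> e" "card e > 0" "p > 0"
  shows "sample_avg p K e S \<le> min (real (card S)) K"
proof -
  let ?n = "real (card e)" and ?s = "real (card S)"
  have "(\<Sum>xs\<in>samples p e. min (hits S xs) (K * real p / ?n))
      \<le> ?n ^ p * min (real p * ?s / ?n) (K * real p / ?n)"
    using sum_min_le[of "hits S" "samples p e"] sum_hits[OF assms(1-3), of p] assms(1)
    by (simp add: card_samples)
  also have "min (real p * ?s / ?n) (K * real p / ?n) = real p / ?n * min ?s K"
    using assms(3,4) by (auto simp: min_def field_simps)
  finally have "sample_avg p K e S \<le> ?n / (real p * ?n ^ p) * (?n ^ p * (real p / ?n * min ?s K))"
    unfolding sample_avg_def by (intro mult_left_mono) auto
  also have "\<dots> = min ?s K"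
    using assms(3,4) by simp
  finally show ?thesis .
qed

lemma sample_avg_ge:
  assumes "finite e" "S \<subseteq> e" "card e > 0" "p > 0" "0 < \<epsilon>" "\<epsilon> < 1"
    and "1 \<le> \<epsilon>\<^sup>2 * (K * real p / real (card e))"
  shows "(1 - \<epsilon>) * min (real (card S)) K \<le> sample_avg p K e S"
proof -
  let ?n = "real (card e)" and ?s = "real (card S)"
  have eq: "min (real p * ?s / ?n) (K * real p / ?n) = real p / ?n * min ?s K"
    using assms(3,4) by (auto simp: min_def field_simps)
  have "?n ^ p * ((1 - \<epsilon>) * min (real p * ?s / ?n) (K * real p / ?n))
      \<le> (\<Sum>xs\<in>samples p e. min (hits S xs) (K * real p / ?n))"
    using sum_min_ge[of "hits S" "samples p e" "real p * ?s / ?n" \<epsilon> "K * real p / ?n"]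
      sum_hits[OF assms(1-3), of p] sum_hits_deviation_le[OF assms(1-3), of p] assms(1,5-7)
    by (simp add: card_samples)
  then have "?n / (real p * ?n ^ p) * (?n ^ p * ((1 - \<epsilon>) * (real p / ?n * min ?s K)))
      \<le> sample_avg p K e S"
    unfolding sample_avg_def eq by (intro mult_left_mono) auto
  moreover have "?n / (real p * ?n ^ p) * (?n ^ p * ((1 - \<epsilon>) * (real p / ?n * min ?s K)))
      = (1 - \<epsilon>) * min ?s K"
    using assms(3,4) by simp
  ultimately show ?thesis by simp
qed

text \<open>For \<open>S\<close> smaller than \<open>K\<close>, an error proportional to
  \<open>K\<close> on the complement would be too large. Here the shortfall of the complement's
  average below \<open>K\<close> is bounded by the shortfall of the average of \<open>S\<close>
  below \<open>card S\<close>.\<close>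

lemma sample_avg_complement_ge:
  assumes "finite e" "S \<subseteq> e" "card e > 0" "p > 0" "2 * K \<le> real (card e)"
  shows "sample_avg p K e S - real (card S) \<le> sample_avg p K e (e - S) - K"
proof -
  let ?n = "real (card e)" and ?s = "real (card S)"
  let ?L = "K * real p / ?n"
  have "2 * K * real p \<le> ?n * real p"
    using assms(5) by (intro mult_right_mono) auto
  then have L: "2 * ?L \<le> real p"
    using assms(3) by (simp add: field_simps)
  \<comment> \<open>Pointwise, with \<open>x = hits S xs\<close>: if \<open>x \<le> ?L\<close>, then
    \<open>real p - x \<ge> ?L\<close> and both sides are 0. Otherwise the left side is
    \<open>?L - x\<close>, and the right side is 0 or \<open>real p - x - ?L\<close>, which is no
    smaller as \<open>2 * ?L \<le> real p\<close>.\<close>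
  have "(\<Sum>xs\<in>samples p e. min (hits S xs) ?L - hits S xs)
      \<le> (\<Sum>xs\<in>samples p e. min (hits (e - S) xs) ?L - ?L)"
    using L by (intro sum_mono) (auto simp: hits_complement min_def)
  then have "(\<Sum>xs\<in>samples p e. min (hits S xs) ?L) - ?n ^ p * (real p * ?s / ?n)
      \<le> (\<Sum>xs\<in>samples p e. min (hits (e - S) xs) ?L) - ?n ^ p * ?L"
    using assms(1) by (simp add: sum_subtractf sum_hits[OF assms(1-3)] card_samples)
  then have "?n / (real p * ?n ^ p) * ((\<Sum>xs\<in>samples p e. min (hits S xs) ?L) - ?n ^ p * (real p * ?s / ?n))
      \<le> ?n / (real p * ?n ^ p) * ((\<Sum>xs\<in>samples p e. min (hits (e - S) xs) ?L) - ?n ^ p * ?L)"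
    by (intro mult_left_mono) auto
  then show ?thesis
    using assms(3,4) by (simp add: right_diff_distrib sample_avg_def)
qed

section \<open>Submodularity of the summands\<close>

text \<open>A concave function of a measure is submodular: union and intersection have the same
  total hit count as the two sets, but spread further apart.\<close>

lemma submodular_min_hits: "submodular_on_subsets E (\<lambda>S. min (hits S xs) L)"
  unfolding submodular_on_subsets_def
proof (intro allI impI)
  fix S T :: "'a set"
  show "min (hits (S \<union> T) xs) L + min (hits (S \<inter> T) xs) L \<le> min (hits S xs) L + min (hits T xs) L"
    using hits_modular[of S T xs] hits_mono[of "S \<inter> T" S xs] hits_mono[of "S \<inter> T" T xs]
    by (auto simp: min_def)
qed

text \<open>The same spreading argument with the order reversed. Counting misses as
  \<open>c - hits S xs\<close>, rather than by a complement, lets \<open>hits_Int_set\<close>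
  restrict them to \<open>set xs\<close>.\<close>

lemma submodular_min_misses: "submodular_on_subsets E (\<lambda>S. min (c - hits S xs) L)"
  unfolding submodular_on_subsets_def
proof (intro allI impI)
  fix S T :: "'a set"
  show "min (c - hits (S \<union> T) xs) L + min (c - hits (S \<inter> T) xs) L
      \<le> min (c - hits S xs) L + min (c - hits T xs) L"
    using hits_modular[of S T xs] hits_mono[of "S \<inter> T" S xs] hits_mono[of "S \<inter> T" T xs]
    by (auto simp: min_def)
qed

lemma submodular_add_const:
  assumes "submodular_on_subsets E f" "submodular_on_subsets E g"
  shows "submodular_on_subsets E (\<lambda>S. f S + g S + d)"
  using assms unfolding submodular_on_subsets_def by (smt (verit))

lemma submodular_scale:
  assumes "submodular_on_subsets E f" "0 \<le> c"
  shows "submodular_on_subsets E (\<lambda>S. c * f S)"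
  unfolding submodular_on_subsets_def
proof (intro allI impI)
  fix S T assume "S \<subseteq> E" "T \<subseteq> E"
  then have "f (S \<union> T) + f (S \<inter> T) \<le> f S + f T"
    using assms(1) by (simp add: submodular_on_subsets_def)
  then show "c * f (S \<union> T) + c * f (S \<inter> T) \<le> c * f S + c * f T"
    using assms(2) by (metis distrib_left mult_left_mono)
qed

section \<open>Approximations assembled from all samples\<close>

text \<open>Any enumeration of a finite index set will do, so the samples can index the summands
  themselves.\<close>

lemma approximable_finite_index:
  fixes E :: "'i \<Rightarrow> 'a set" and h :: "'i \<Rightarrow> 'a set \<Rightarrow> real"
  assumes "finite I" "nonneg_on_subsets e g"
    and parts: "\<And>i. i \<in> I \<Longrightarrow> E i \<subseteq> e \<and> card (E i) \<le> p \<and>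
          nonneg_on_subsets (E i) (h i) \<and> submodular_on_subsets (E i) (h i)"
    and sum: "\<And>S. S \<subseteq> e \<Longrightarrow> (\<Sum>i\<in>I. h i (S \<inter> E i)) \<in> {(1 - \<epsilon>) * g S .. (1 + \<epsilon>) * g S}"
  shows "approximable e g \<epsilon> p"
proof -
  obtain b where b: "bij_betw b {1..card I} I"
    using ex_bij_betw_nat_finite_1[OF assms(1)] by blast
  have "(\<Sum>i=1..card I. h (b i) (S \<inter> E (b i))) = (\<Sum>i\<in>I. h i (S \<inter> E i))" for S
    using sum.reindex_bij_betw[OF b, of "\<lambda>i. h i (S \<inter> E i)"] by simp
  moreover have "b i \<in> I" if "i \<in> {1..card I}" for i
    using b that by (auto simp: bij_betw_def)
  ultimately show ?thesis
    unfolding approximable_def using assms(2) parts sum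
    by (intro conjI exI[of _ "card I"] exI[of _ "\<lambda>i. E (b i)"] exI[of _ "\<lambda>i. h (b i)"]) auto
qed

lemma card_set_sample_le: "xs \<in> samples p e \<Longrightarrow> card (set xs) \<le> p"
  using card_length by (auto simp: samples_def)

lemma approximable_min_card:
  assumes "finite e" "card e > 0" "p > 0" "0 < \<epsilon>" "\<epsilon> < 1" "K > 0"
    and "1 \<le> \<epsilon>\<^sup>2 * (K * real p / real (card e))"
    and g: "\<And>S. S \<subseteq> e \<Longrightarrow> g S = min (real (card S)) K"
  shows "approximable e g \<epsilon> p"
proof -
  let ?c = "real (card e) / (real p * real (card e) ^ p)"
  let ?L = "K * real p / real (card e)"
  show ?thesis
  proof (rule approximable_finite_index[where I = "samples p e" and E = set
        and h = "\<lambda>xs S. ?c * min (hits S xs) ?L"])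
    show "finite (samples p e)" by (rule finite_samples[OF assms(1)])
    show "nonneg_on_subsets e g"
      using g assms(6) by (simp add: nonneg_on_subsets_def)
  next
    fix xs assume xs: "xs \<in> samples p e"
    have "nonneg_on_subsets (set xs) (\<lambda>S. ?c * min (hits S xs) ?L)"
      using assms(6) by (simp add: nonneg_on_subsets_def hits_nonneg)
    moreover have "submodular_on_subsets (set xs) (\<lambda>S. ?c * min (hits S xs) ?L)"
      by (intro submodular_scale submodular_min_hits) simp
    ultimately show "set xs \<subseteq> e \<and> card (set xs) \<le> p \<and>
        nonneg_on_subsets (set xs) (\<lambda>S. ?c * min (hits S xs) ?L) \<and>
        submodular_on_subsets (set xs) (\<lambda>S. ?c * min (hits S xs) ?L)"
      using xs card_set_sample_le[OF xs] by (auto simp: samples_def)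
  next
    fix S assume S: "S \<subseteq> e"
    have "(\<Sum>xs\<in>samples p e. ?c * min (hits (S \<inter> set xs) xs) ?L) = sample_avg p K e S"
      unfolding sample_avg_def hits_Int_set by (simp only: sum_distrib_left)
    moreover have "sample_avg p K e S \<le> g S"
      using sample_avg_le[OF assms(1) S assms(2,3)] g[OF S] by simp
    moreover have "(1 - \<epsilon>) * g S \<le> sample_avg p K e S"
      using sample_avg_ge[OF assms(1) S assms(2-5,7)] g[OF S] by simp
    \<comment> \<open>The average never exceeds \<open>g S\<close>, so nonnegativity of the slack
      gives the upper end of the interval.\<close>
    moreover have "0 \<le> \<epsilon> * g S"
      using g[OF S] assms(4,6) by simp
    ultimately show "(\<Sum>xs\<in>samples p e. ?c * min (hits (S \<inter> set xs) xs) ?L)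
        \<in> {(1 - \<epsilon>) * g S .. (1 + \<epsilon>) * g S}"
      by (simp add: algebra_simps)
  qed
qed

text \<open>The two averages lose at most \<open>\<delta>\<close> times the target each. If
  \<open>card S < K\<close>, the loss on the complement is controlled by that on \<open>S\<close>;
  otherwise both sides have size at least \<open>K\<close>, and each average loses at most
  \<open>\<delta> * K\<close>.\<close>

lemma sample_avg_two_sided_ge:
  assumes "finite e" "S \<subseteq> e" "card e > 0" "p > 0" "0 < \<delta>" "\<delta> < 1" "2 * K \<le> real (card e)"
    and "1 \<le> \<delta>\<^sup>2 * (K * real p / real (card e))"
    and le: "card S \<le> card (e - S)"
  shows "(1 - 2 * \<delta>) * min (real (card S)) (min (real (card (e - S))) K)
    \<le> sample_avg p K e S + sample_avg p K e (e - S) - K"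
proof (cases "real (card S) < K")
  case True
  then have "(1 - \<delta>) * real (card S) \<le> sample_avg p K e S"
    using sample_avg_ge[OF assms(1-6,8)] by simp
  moreover have "sample_avg p K e S - real (card S) \<le> sample_avg p K e (e - S) - K"
    by (rule sample_avg_complement_ge[OF assms(1-4,7)])
  moreover have "min (real (card S)) (min (real (card (e - S))) K) = real (card S)"
    using True le by simp
  ultimately show ?thesis
    by (simp add: algebra_simps)
next
  case False
  then have "K \<le> real (card S)" "K \<le> real (card (e - S))"
    using le by linarith+
  then show ?thesis
    using sample_avg_ge[OF assms(1-6,8)] sample_avg_ge[OF assms(1) Diff_subset[of e S] assms(3-6,8)]
    by (simp add: min_absorb2 algebra_simps)
qed

lemma approximable_min_card_complement:
  assumes "finite e" "card e > 0" "p > 0" "0 < \<epsilon>" "\<epsilon> < 1" "K > 0" "2 * K \<le> real (card e)"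
    and large: "1 \<le> (\<epsilon> / 2)\<^sup>2 * (K * real p / real (card e))"
    and g: "\<And>S. S \<subseteq> e \<Longrightarrow> g S = min (real (card S)) (min (real (card (e - S))) K)"
  shows "approximable e g \<epsilon> p"
proof -
  let ?n = "real (card e)"
  let ?c = "?n / (real p * ?n ^ p)"
  let ?L = "K * real p / ?n"
  let ?h = "\<lambda>xs S. ?c * (min (hits S xs) ?L + min (real p - hits S xs) ?L + (- ?L))"
  have "K * real p \<le> ?n * real p"
    using assms(6,7) by (intro mult_right_mono) auto
  then have L: "0 \<le> ?L" "?L \<le> real p"
    using assms(2,6) by (auto simp: field_simps)
  show ?thesis
  proof (rule approximable_finite_index[where I = "samples p e" and E = set and h = ?h])
    show "finite (samples p e)" by (rule finite_samples[OF assms(1)])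
    show "nonneg_on_subsets e g"
      using g assms(6) by (simp add: nonneg_on_subsets_def)
  next
    fix xs assume xs: "xs \<in> samples p e"
    have "hits S xs \<le> real p" for S
      using xs by (simp add: hits_def samples_def) (metis length_filter_le)
    \<comment> \<open>Either one of the minima equals \<open>?L\<close>, or the sum is
      \<open>real p - ?L\<close>, nonnegative by \<open>L\<close>.\<close>
    then have "0 \<le> min (hits S xs) ?L + min (real p - hits S xs) ?L + (- ?L)" for S
      using L hits_nonneg[of S xs] by (smt (verit))
    then have "nonneg_on_subsets (set xs) (?h xs)"
      unfolding nonneg_on_subsets_def by (intro allI impI mult_nonneg_nonneg) auto
    moreover have "submodular_on_subsets (set xs) (?h xs)"
      by (intro submodular_scale submodular_add_const submodular_min_hits submodular_min_misses) simp
    ultimately show "set xs \<subseteq> e \<and> card (set xs) \<le> p \<and>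
        nonneg_on_subsets (set xs) (?h xs) \<and> submodular_on_subsets (set xs) (?h xs)"
      using xs card_set_sample_le[OF xs] by (auto simp: samples_def)
  next
    fix S assume S: "S \<subseteq> e"
    have SS: "e - (e - S) = S" using S by auto
    have ne: "e \<noteq> {}" using assms(2) by auto
    have "?n = real (card S) + real (card (e - S))"
      using S assms(1) by (metis card_Diff_subset card_mono finite_subset le_add_diff_inverse of_nat_add)
    \<comment> \<open>The two sizes add up to at least \<open>2 * K\<close>, so one of them is at
      least \<open>K\<close> and its truncation cancels against \<open>- K\<close>.\<close>
    then have eq: "min (real (card S)) K + min (real (card (e - S))) K - K = g S"
      using g[OF S] assms(7) by (auto simp: min_def)
    have "(\<Sum>xs\<in>samples p e. ?h xs (S \<inter> set xs))
        = (\<Sum>xs\<in>samples p e. ?c * (min (hits S xs) ?L + min (hits (e - S) xs) ?L + (- ?L)))"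
      by (rule sum.cong) (auto simp: hits_Int_set hits_complement)
    also have "\<dots> = sample_avg p K e S + sample_avg p K e (e - S) - K"
      unfolding sum_distrib_left[symmetric] sum.distrib sample_avg_def
      using assms(1-3) ne by (simp add: card_samples distrib_left right_diff_distrib)
    finally have sum: "(\<Sum>xs\<in>samples p e. ?h xs (S \<inter> set xs))
        = sample_avg p K e S + sample_avg p K e (e - S) - K" .
    have "sample_avg p K e S + sample_avg p K e (e - S) - K \<le> g S"
      using sample_avg_le[OF assms(1) S assms(2,3), of K]
        sample_avg_le[OF assms(1) Diff_subset[of e S] assms(2,3), of K] eq by linarith
    moreover have "0 \<le> \<epsilon> * g S"
      using g[OF S] assms(4,6) by simp
    moreover have "(1 - \<epsilon>) * g S \<le> sample_avg p K e S + sample_avg p K e (e - S) - K"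
    proof (cases "card S \<le> card (e - S)")
      case True
      then show ?thesis
        using sample_avg_two_sided_ge[OF assms(1) S assms(2,3) _ _ assms(7) large] assms(4,5) g[OF S]
        by simp
    next
      case False
      then show ?thesis
        using sample_avg_two_sided_ge[OF assms(1) Diff_subset[of e S] assms(2,3) _ _ assms(7) large]
          assms(4,5) g[OF S]
        by (simp add: SS min.left_commute)
    qed
    ultimately show "(\<Sum>xs\<in>samples p e. ?h xs (S \<inter> set xs)) \<in> {(1 - \<epsilon>) * g S .. (1 + \<epsilon>) * g S}"
      unfolding sum by (simp add: algebra_simps)
  qed
qed

section \<open>Choice of the sample size and the final bound\<close>

text \<open>Round \<open>n / (\<delta>\<^sup>2 * K)\<close> up; this quotient is at least 1, so
  rounding at most doubles it.\<close>

lemma sample_size_exists: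
  fixes n K \<delta> :: real
  assumes "0 < K" "K \<le> n" "0 < \<delta>" "\<delta> < 1"
  obtains p :: nat where "p > 0" "1 \<le> \<delta>\<^sup>2 * (K * real p / n)" "real p \<le> 2 * (n / (\<delta>\<^sup>2 * K))"
proof -
  define q where "q = n / (\<delta>\<^sup>2 * K)"
  have d: "\<delta>\<^sup>2 * K > 0" "n > 0" using assms by auto
  have "\<delta>\<^sup>2 * K \<le> 1 * K"
    using assms by (intro mult_right_mono) (auto simp: power_le_one)
  also have "\<dots> \<le> n" using assms by simp
  finally have q: "q \<ge> 1" using d by (simp add: q_def)
  have "real (nat \<lceil>q\<rceil>) \<ge> q" "real (nat \<lceil>q\<rceil>) \<le> q + 1"
    using q by linarith+
  then obtain p :: nat where p: "q \<le> real p" "real p \<le> q + 1" by blast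
  then have "p > 0" "real p \<le> 2 * q" using q by linarith+
  moreover have "1 \<le> \<delta>\<^sup>2 * (K * real p / n)"
    using p(1) d by (simp add: q_def field_simps)
  ultimately show ?thesis using that unfolding q_def by blast
qed

theorem theorem3:
  "\<exists>C>0. \<forall>(e :: 'a set) (K :: real) (g :: 'a set \<Rightarrow> real) (\<epsilon> :: real).
     finite e \<longrightarrow> K > 0 \<longrightarrow>
     (\<forall>S. S \<subseteq> e \<longrightarrow> g S = min (real (card S)) K) \<or>
     (\<forall>S. S \<subseteq> e \<longrightarrow> g S = min (real (card S)) (min (real (card (e - S))) K)) \<longrightarrow>
     0 < \<epsilon> \<longrightarrow> \<epsilon> < 1 \<longrightarrow>
     (\<exists>p :: nat. approximable e g \<epsilon> p \<and>
        real p \<le> C * ((1 / \<epsilon>\<^sup>2) * (real (card e) / min K (real (card e))) * ln (max 2 (real (card e)))))"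
proof (rule exI[of _ 32], intro conjI allI impI)
  fix e :: "'a set" and K :: real and g :: "'a set \<Rightarrow> real" and \<epsilon> :: real
  assume fin: "finite e" and K: "K > 0" and eps: "0 < \<epsilon>" "\<epsilon> < 1"
    and g: "(\<forall>S. S \<subseteq> e \<longrightarrow> g S = min (real (card S)) K) \<or>
     (\<forall>S. S \<subseteq> e \<longrightarrow> g S = min (real (card S)) (min (real (card (e - S))) K))"
  let ?n = "real (card e)"
  let ?B = "(1 / \<epsilon>\<^sup>2) * (?n / min K ?n)"
  \<comment> \<open>The constant 32 is the product of 2 from rounding, 4 from
    \<open>\<epsilon> / 2\<close>, 2 from halving the cap, and 2 from
    \<open>ln 2 \<ge> 1 / 2\<close>.\<close>
  show "\<exists>p. approximable e g \<epsilon> p \<and> real p \<le> 32 * (?B * ln (max 2 ?n))"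
  proof (cases "e = {}")
    case True
    \<comment> \<open>For empty \<open>e\<close> the bound is 0, since \<open>0 / 0 = 0\<close>; the
      empty sum attains it.\<close>
    with g K have "g {} = 0" by auto
    with True have "approximable e g \<epsilon> 0"
      by (intro approximable_finite_index[where I = "{} :: nat set"]) (auto simp: nonneg_on_subsets_def)
    with True show ?thesis by (intro exI[of _ 0]) simp
  next
    case False
    then have n: "card e > 0" using fin by (simp add: card_gt_0_iff)
    have B: "?B \<ge> 0" using K by simp
    \<comment> \<open>This is \<open>ln x \<le> x - 1\<close> at \<open>x = 1 / 2\<close>.\<close>
    have "1 / 2 \<le> ln (2 :: real)"
      using ln_le_minus_one[of "1 / 2 :: real"] by (simp add: ln_div)
    also have "\<dots> \<le> ln (max 2 ?n)" by (subst ln_le_cancel_iff) auto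
    finally have "?B * (1 / 2) \<le> ?B * ln (max 2 ?n)"
      using B by (intro mult_left_mono)
    moreover have "16 * b \<le> 32 * (b * l)" if "b * (1 / 2) \<le> b * l" for b l :: real
      using that by simp
    ultimately have *: "16 * ?B \<le> 32 * (?B * ln (max 2 ?n))" by blast
    have cS: "card S \<le> card e" "card (e - S) = card e - card S" if "S \<subseteq> e" for S
      using that fin by (auto intro: card_mono simp: card_Diff_subset finite_subset)
    from g show ?thesis
    proof
      assume g: "\<forall>S. S \<subseteq> e \<longrightarrow> g S = min (real (card S)) K"
      obtain p :: nat where p: "p > 0" "1 \<le> \<epsilon>\<^sup>2 * (min K ?n * real p / ?n)"
        "real p \<le> 2 * (?n / (\<epsilon>\<^sup>2 * min K ?n))"
      proof (rule sample_size_exists)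
        show "0 < min K ?n" "min K ?n \<le> ?n" using K n by auto
      qed (use eps in auto)
      have "g S = min (real (card S)) (min K ?n)" if "S \<subseteq> e" for S
        using g that cS(1)[OF that] by (auto simp: min_def)
      then have "approximable e g \<epsilon> p"
        using K n by (intro approximable_min_card[OF fin n p(1) eps _ p(2)]) auto
      moreover have "real p \<le> 16 * ?B"
        using p(3) B by simp
      ultimately show ?thesis using * by (intro exI[of _ p]) linarith
    next
      assume g: "\<forall>S. S \<subseteq> e \<longrightarrow> g S = min (real (card S)) (min (real (card (e - S))) K)"
      \<comment> \<open>The errors from \<open>S\<close> and \<open>e - S\<close> add up, hence
        \<open>\<epsilon> / 2\<close>. The smaller of the two sets has at most \<open>?n / 2\<close>
        elements, so capping \<open>K\<close> there preserves \<open>g\<close> and secures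
        \<open>2 * K \<le> ?n\<close> for the new cap.\<close>
      obtain p :: nat where p: "p > 0" "1 \<le> (\<epsilon> / 2)\<^sup>2 * (min K (?n / 2) * real p / ?n)"
        "real p \<le> 2 * (?n / ((\<epsilon> / 2)\<^sup>2 * min K (?n / 2)))"
      proof (rule sample_size_exists)
        show "0 < min K (?n / 2)" "min K (?n / 2) \<le> ?n" using K n by auto
        show "0 < \<epsilon> / 2" "\<epsilon> / 2 < 1" using eps by auto
      qed
      have "g S = min (real (card S)) (min (real (card (e - S))) (min K (?n / 2)))" if "S \<subseteq> e" for S
        using g that cS[OF that] by (auto simp: min_def of_nat_diff)
      then have "approximable e g \<epsilon> p"
        using K n by (intro approximable_min_card_complement[OF fin n p(1) eps _ _ p(2)]) auto
      moreover have "real p \<le> 16 * ?B"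
      proof -
        \<comment> \<open>Lowering the cap from \<open>min K ?n\<close> to
          \<open>min K (?n / 2)\<close> costs at most a factor 2.\<close>
        have "(\<epsilon> / 2)\<^sup>2 * (min K ?n / 2) \<le> (\<epsilon> / 2)\<^sup>2 * min K (?n / 2)"
          using K n by (intro mult_left_mono) auto
        then have "?n / ((\<epsilon> / 2)\<^sup>2 * min K (?n / 2)) \<le> ?n / ((\<epsilon> / 2)\<^sup>2 * (min K ?n / 2))"
          using K n eps by (intro divide_left_mono) auto
        also have "\<dots> = 8 * ?B" by (simp add: power2_eq_square)
        finally show ?thesis using p(3) by linarith
      qed
      ultimately show ?thesis using * by (intro exI[of _ p]) linarith
    qed
  qed
qed simp

end
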